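(* Let $(M,g)$ and $(N,h)$ be connected Riemannian manifolds, $\Gamma$ a group acting by isometries on $M$ and $N$, and let $f,f':(M,g)\to(N,h)$ be two lipschitz-homotopy equivalences. If $f\sim_\Gamma f'$, then $$C^*_f(M\sqcup N)^\Gamma=C^*_{f'}(M\sqcup N)^\Gamma\qquad\text{and}\qquad D^*_f(M\sqcup N)^\Gamma=D^*_{f'}(M\sqcup N)^\Gamma.$$
   Context: $f\sim_\Gamma f'$: both maps are $\Gamma$-equivariant and there is a $\Gamma$-equivariant lipschitz homotopy $M\times[0,1]\to N$ between them (product metric, trivial action on $[0,1]$). A lipschitz-homotopy equivalence is a ($\Gamma$-equivariant) lipschitz map with a ($\Gamma$-equivariant) lipschitz homotopy inverse such that both compositions are joined to the identities by ($\Gamma$-equivariant) lipschitz homotopies. Coarse structure and algebras. Given $f$, two maps $p_1,p_2:S\to M\sqcup N$ are close if there is $C$ with $d_N((f\sqcup\mathrm{id}_N)p_1(x),(f\sqcup\mathrm{id}_N)p_2(x))\le C$ for all $x\in S$; a subset of $(M\sqcup N)^2$ is controlled if the two projections restricted to it are close. On $\mathcal L^2(M\sqcup N)$ (square integrable complex forms) $C_0(M\sqcup N)$ acts by multiplication and $\Gamma$ by pullback. The support of an operator $T$ is the complement of the union of all open $U\times V$ with $\phi T\psi=0$ for all $\phi\in C_0(U),\psi\in C_0(V)$; $T$ is controlled if its support is controlled, pseudo-local if $[\phi,T]$ is compact for all $\phi\in C_0(M\sqcup N)$, locally compact if $\phi T$ and $T\phi$ are compact for all $\phi\in C_0(M\sqcup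 N)$. $D^*_f(M\sqcup N)^\Gamma$ is the norm closure of the $\Gamma$-invariant, controlled, pseudo-local operators, and $C^*_f(M\sqcup N)^\Gamma$ the norm closure of those which are moreover locally compact. *)

theory Defs
  imports
    "HOL-Analysis.Analysis"
    "HOL-Algebra.Group_Action"
    "Jordan_Normal_Form.Determinant"
begin

section \<open>Smooth manifolds\<close>

text \<open>Coordinates live in \<^term>\<open>Euclidean_space n\<close>, the sequences vanishing from index \<open>n\<close> on.
  The dimension belongs to the chart, so that a disjoint union of manifolds of different
  dimensions is covered; on a connected manifold it is constant.\<close>

definition partial :: "nat \<Rightarrow> ((nat \<Rightarrow> real) \<Rightarrow> real) \<Rightarrow> (nat \<Rightarrow> real) \<Rightarrow> real" where
  "partial i h x = deriv (\<lambda>t. h (x(i := t))) (x i)"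

primrec Ck_on :: "nat \<Rightarrow> nat \<Rightarrow> (nat \<Rightarrow> real) set \<Rightarrow> ((nat \<Rightarrow> real) \<Rightarrow> real) \<Rightarrow> bool" where
  "Ck_on 0 n W h \<longleftrightarrow> continuous_on W h"
| "Ck_on (Suc k) n W h \<longleftrightarrow> continuous_on W h \<and>
     (\<forall>i<n. (\<forall>x\<in>W. (\<lambda>t. h (x(i := t))) differentiable (at (x i))) \<and> Ck_on k n W (partial i h))"

definition smooth_on :: "nat \<Rightarrow> (nat \<Rightarrow> real) set \<Rightarrow> ((nat \<Rightarrow> real) \<Rightarrow> real) \<Rightarrow> bool" where
  "smooth_on n W h \<longleftrightarrow> (\<forall>k. Ck_on k n W h)"

record 'a chart =
  cdim :: nat
  cdom :: "'a set"
  cmap :: "'a \<Rightarrow> nat \<Rightarrow> real"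

definition cinv :: "'a chart \<Rightarrow> (nat \<Rightarrow> real) \<Rightarrow> 'a" where
  "cinv c = inv_into (cdom c) (cmap c)"

definition is_chart :: "'a::topological_space chart \<Rightarrow> bool" where
  "is_chart c \<longleftrightarrow> open (cdom c) \<and> openin (Euclidean_space (cdim c)) (cmap c ` cdom c) \<and>
     homeomorphism (cdom c) (cmap c ` cdom c) (cmap c) (cinv c)"

definition smooth_atlas :: "'a::topological_space chart set \<Rightarrow> bool" where
  "smooth_atlas A \<longleftrightarrow> (\<forall>c\<in>A. is_chart c) \<and> (\<Union>c\<in>A. cdom c) = UNIV \<and>
     (\<forall>c\<in>A. \<forall>d\<in>A. \<forall>i. smooth_on (cdim c) (cmap c ` (cdom c \<inter> cdom d)) (\<lambda>x. cmap d (cinv c x) i))"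

definition smooth_functions :: "'a chart set \<Rightarrow> ('a \<Rightarrow> real) set" where
  "smooth_functions A = {u. \<forall>c\<in>A. smooth_on (cdim c) (cmap c ` cdom c) (\<lambda>x. u (cinv c x))}"

definition smooth_map ::
  "'a::topological_space chart set \<Rightarrow> 'b::topological_space chart set \<Rightarrow> ('a \<Rightarrow> 'b) \<Rightarrow> bool" where
  "smooth_map A B F \<longleftrightarrow> continuous_on UNIV F \<and>
     (\<forall>c\<in>A. \<forall>d\<in>B. \<forall>i.
        smooth_on (cdim c) (cmap c ` (cdom c \<inter> F -` cdom d)) (\<lambda>x. cmap d (F (cinv c x)) i))"

text \<open>A tangent vector at \<open>p\<close> is a derivation at \<open>p\<close> of the algebra of smooth functions,
  extended by \<open>0\<close> to the functions that are not smooth.\<close>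

type_synonym 'a tangent = "('a \<Rightarrow> real) \<Rightarrow> real"

definition tangent_space :: "'a chart set \<Rightarrow> 'a \<Rightarrow> 'a tangent set" where
  "tangent_space A p = {X.
     (\<forall>u. u \<notin> smooth_functions A \<longrightarrow> X u = 0) \<and>
     (\<forall>u\<in>smooth_functions A. \<forall>v\<in>smooth_functions A. \<forall>a b.
        X (\<lambda>q. a * u q + b * v q) = a * X u + b * X v) \<and>
     (\<forall>u\<in>smooth_functions A. \<forall>v\<in>smooth_functions A.
        X (\<lambda>q. u q * v q) = u p * X v + v p * X u)}"

definition coord_vector :: "'a chart set \<Rightarrow> 'a chart \<Rightarrow> nat \<Rightarrow> 'a \<Rightarrow> 'a tangent" where
  "coord_vector A c i p =
     (\<lambda>u. if u \<in> smooth_functions A then partial i (\<lambda>x. u (cinv c x)) (cmap c p) else 0)"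

definition differential :: "'b chart set \<Rightarrow> ('a \<Rightarrow> 'b) \<Rightarrow> 'a tangent \<Rightarrow> 'b tangent" where
  "differential B F X = (\<lambda>u. if u \<in> smooth_functions B then X (\<lambda>q. u (F q)) else 0)"

definition velocity :: "'a chart set \<Rightarrow> (real \<Rightarrow> 'a) \<Rightarrow> real \<Rightarrow> 'a tangent" where
  "velocity A \<gamma> t = (\<lambda>u. if u \<in> smooth_functions A then deriv (\<lambda>s. u (\<gamma> s)) t else 0)"


section \<open>Riemannian manifolds\<close>

record 'a riemannian =
  atlas :: "'a chart set"
  metr :: "'a \<Rightarrow> 'a tangent \<Rightarrow> 'a tangent \<Rightarrow> real"

definition tspace :: "'a riemannian \<Rightarrow> 'a \<Rightarrow> 'a tangent set" where
  "tspace M = tangent_space (atlas M)"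

definition riemannian_metric ::
  "'a chart set \<Rightarrow> ('a \<Rightarrow> 'a tangent \<Rightarrow> 'a tangent \<Rightarrow> real) \<Rightarrow> bool" where
  "riemannian_metric A g \<longleftrightarrow>
     (\<forall>p. \<forall>X\<in>tangent_space A p. \<forall>Y\<in>tangent_space A p. g p X Y = g p Y X) \<and>
     (\<forall>p. \<forall>X\<in>tangent_space A p. \<forall>Y\<in>tangent_space A p. \<forall>Z\<in>tangent_space A p. \<forall>a b.
        g p (\<lambda>u. a * X u + b * Y u) Z = a * g p X Z + b * g p Y Z) \<and>
     (\<forall>p. \<forall>X\<in>tangent_space A p. X \<noteq> (\<lambda>u. 0) \<longrightarrow> g p X X > 0) \<and>
     (\<forall>c\<in>A. \<forall>i<cdim c. \<forall>j<cdim c. smooth_on (cdim c) (cmap c ` cdom c)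
        (\<lambda>x. g (cinv c x) (coord_vector A c i (cinv c x)) (coord_vector A c j (cinv c x))))"

text \<open>The Hausdorff property and second countability are imposed on the carrier type by the
  classes \<^class>\<open>t2_space\<close> and \<^class>\<open>second_countable_topology\<close> where manifolds are introduced.\<close>

definition riemannian_manifold :: "'a::topological_space riemannian \<Rightarrow> bool" where
  "riemannian_manifold M \<longleftrightarrow> smooth_atlas (atlas M) \<and> riemannian_metric (atlas M) (metr M)"

text \<open>The analogue of \<^const>\<open>piecewise_C1_differentiable_on\<close>, with a finite exceptional set that
  does not depend on the test function. The one-sided derivatives at the exceptional parameters
  need not exist; the length may then be infinite, which does not affect the infimum.\<close>

definition piecewise_C1_curve :: "'a::topological_space chart set \<Rightarrow> (real \<Rightarrow> 'a) \<Rightarrow> bool" where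
  "piecewise_C1_curve A \<gamma> \<longleftrightarrow> continuous_on {0..1} \<gamma> \<and>
     (\<exists>S. finite S \<and> (\<forall>u\<in>smooth_functions A. (\<lambda>t. u (\<gamma> t)) C1_differentiable_on ({0..1} - S)))"

definition curve_length :: "'a riemannian \<Rightarrow> (real \<Rightarrow> 'a) \<Rightarrow> ennreal" where
  "curve_length M \<gamma> = (\<integral>\<^sup>+ t \<in> {0..1}.
     ennreal (sqrt (metr M (\<gamma> t) (velocity (atlas M) \<gamma> t) (velocity (atlas M) \<gamma> t))) \<partial>lborel)"

text \<open>The infimum is finite on a connected manifold, so nothing is lost in passing to \<^typ>\<open>real\<close>.\<close>

definition riem_dist :: "'a::topological_space riemannian \<Rightarrow> 'a \<Rightarrow> 'a \<Rightarrow> real" where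
  "riem_dist M p q = enn2real
     (INF \<gamma> \<in> {\<gamma>. piecewise_C1_curve (atlas M) \<gamma> \<and> \<gamma> 0 = p \<and> \<gamma> 1 = q}. curve_length M \<gamma>)"

definition riem_isometry :: "'a::topological_space riemannian \<Rightarrow> ('a \<Rightarrow> 'a) \<Rightarrow> bool" where
  "riem_isometry M F \<longleftrightarrow> bij F \<and> smooth_map (atlas M) (atlas M) F \<and>
     smooth_map (atlas M) (atlas M) (inv_into UNIV F) \<and>
     (\<forall>p. \<forall>X\<in>tspace M p. \<forall>Y\<in>tspace M p.
        metr M (F p) (differential (atlas M) F X) (differential (atlas M) F Y) = metr M p X Y)"

definition acts_by_isometries ::
  "('g, 'k) monoid_scheme \<Rightarrow> 'a::topological_space riemannian \<Rightarrow> ('g \<Rightarrow> 'a \<Rightarrow> 'a) \<Rightarrow> bool" where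
  "acts_by_isometries G M \<rho> \<longleftrightarrow>
     group_action G UNIV \<rho> \<and> (\<forall>\<gamma>\<in>carrier G. riem_isometry M (\<rho> \<gamma>))"

definition lebesgue_on_Rn :: "nat \<Rightarrow> (nat \<Rightarrow> real) measure" where
  "lebesgue_on_Rn n = distr (Pi\<^sub>M {..<n} (\<lambda>_. lborel)) borel (\<lambda>x i. if i < n then x i else 0)"

definition gram_matrix :: "'a riemannian \<Rightarrow> 'a chart \<Rightarrow> 'a \<Rightarrow> real mat" where
  "gram_matrix M c p = mat (cdim c) (cdim c)
     (\<lambda>(i, j). metr M p (coord_vector (atlas M) c i p) (coord_vector (atlas M) c j p))"

text \<open>The Riemannian density is the only Borel measure given by the following formula in every
  chart; no orientation is involved.\<close>

definition riem_volume :: "'a::topological_space riemannian \<Rightarrow> 'a measure" where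
  "riem_volume M = (THE \<mu>. sets \<mu> = sets borel \<and>
     (\<forall>c\<in>atlas M. \<forall>B\<in>sets borel. B \<subseteq> cdom c \<longrightarrow>
        emeasure \<mu> B = (\<integral>\<^sup>+ x \<in> cmap c ` B.
          ennreal (sqrt (Determinant.det (gram_matrix M c (cinv c x)))) \<partial>lebesgue_on_Rn (cdim c))))"


section \<open>Square integrable complex forms\<close>

text \<open>A form has components of all degrees: its value at \<open>p\<close> on a list of \<open>k\<close> tangent vectors at
  \<open>p\<close> is that of its component of degree \<open>k\<close>. On other lists the value is \<open>0\<close> by convention.\<close>

type_synonym 'a form = "'a \<Rightarrow> 'a tangent list \<Rightarrow> complex"

definition alternating_at :: "'a riemannian \<Rightarrow> 'a \<Rightarrow> ('a tangent list \<Rightarrow> complex) \<Rightarrow> bool" where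
  "alternating_at M p \<alpha> \<longleftrightarrow>
     (\<forall>xs. \<not> set xs \<subseteq> tspace M p \<longrightarrow> \<alpha> xs = 0) \<and>
     (\<forall>xs i X Y a b. set xs \<subseteq> tspace M p \<and> i < length xs \<and> X \<in> tspace M p \<and> Y \<in> tspace M p \<longrightarrow>
        \<alpha> (xs[i := (\<lambda>u. a * X u + b * Y u)]) =
          of_real a * \<alpha> (xs[i := X]) + of_real b * \<alpha> (xs[i := Y])) \<and>
     (\<forall>xs. \<not> distinct xs \<longrightarrow> \<alpha> xs = 0)"

definition orthonormal_basis :: "'a riemannian \<Rightarrow> 'a \<Rightarrow> 'a tangent list \<Rightarrow> bool" where
  "orthonormal_basis M p es \<longleftrightarrow> set es \<subseteq> tspace M p \<and>
     (\<forall>i<length es. \<forall>j<length es. metr M p (es ! i) (es ! j) = of_bool (i = j)) \<and>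
     (\<forall>X\<in>tspace M p. X = (\<lambda>u. \<Sum>i<length es. metr M p X (es ! i) * (es ! i) u))"

text \<open>Squared pointwise norm: the sum of \<open>|\<alpha>(e\<^sub>i\<^sub>1, \<dots>, e\<^sub>i\<^sub>k)|\<close> squared over all \<open>i\<^sub>1 < \<dots> < i\<^sub>k\<close> and all
  \<open>k\<close>, for an orthonormal basis \<open>e\<close> of the tangent space, on which it does not depend.\<close>

definition form_norm2 :: "'a riemannian \<Rightarrow> 'a \<Rightarrow> ('a tangent list \<Rightarrow> complex) \<Rightarrow> real" where
  "form_norm2 M p \<alpha> = (let es = (SOME es. orthonormal_basis M p es) in
     \<Sum>I\<in>Pow {..<length es}. (cmod (\<alpha> (nths es I)))\<^sup>2)"

definition measurable_form :: "'a::topological_space riemannian \<Rightarrow> 'a form \<Rightarrow> bool" where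
  "measurable_form M \<omega> \<longleftrightarrow> (\<forall>p. alternating_at M p (\<omega> p)) \<and>
     (\<forall>c\<in>atlas M. \<forall>is. set is \<subseteq> {..<cdim c} \<longrightarrow>
        (\<lambda>p. \<omega> p (map (\<lambda>i. coord_vector (atlas M) c i p) is))
          \<in> borel_measurable (restrict_space borel (cdom c)))"

definition square_integrable_forms :: "'a::topological_space riemannian \<Rightarrow> 'a form set" where
  "square_integrable_forms M = {\<omega>. measurable_form M \<omega> \<and>
     (\<integral>\<^sup>+ p. ennreal (form_norm2 M p (\<omega> p)) \<partial>riem_volume M) < \<infinity>}"

definition ae_equal :: "'a::topological_space riemannian \<Rightarrow> ('a form \<times> 'a form) set" where
  "ae_equal M = {(\<omega>, \<eta>). \<omega> \<in> square_integrable_forms M \<and> \<eta> \<in> square_integrable_forms M \<and>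
     (AE p in riem_volume M. \<omega> p = \<eta> p)}"

type_synonym 'a l2 = "'a form set"

definition L2 :: "'a::topological_space riemannian \<Rightarrow> 'a l2 set" where
  "L2 M = square_integrable_forms M // ae_equal M"

definition l2_class :: "'a::topological_space riemannian \<Rightarrow> 'a form \<Rightarrow> 'a l2" where
  "l2_class M \<omega> = ae_equal M `` {\<omega>}"

definition l2_rep :: "'a l2 \<Rightarrow> 'a form" where
  "l2_rep \<xi> = (SOME \<omega>. \<omega> \<in> \<xi>)"

definition l2_zero :: "'a::topological_space riemannian \<Rightarrow> 'a l2" where
  "l2_zero M = l2_class M (\<lambda>p xs. 0)"

definition l2_add :: "'a::topological_space riemannian \<Rightarrow> 'a l2 \<Rightarrow> 'a l2 \<Rightarrow> 'a l2" where
  "l2_add M \<xi> \<zeta> = l2_class M (\<lambda>p xs. l2_rep \<xi> p xs + l2_rep \<zeta> p xs)"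

definition l2_mult :: "'a::topological_space riemannian \<Rightarrow> ('a \<Rightarrow> complex) \<Rightarrow> 'a l2 \<Rightarrow> 'a l2" where
  "l2_mult M \<phi> \<xi> = l2_class M (\<lambda>p xs. \<phi> p * l2_rep \<xi> p xs)"

definition l2_scale :: "'a::topological_space riemannian \<Rightarrow> complex \<Rightarrow> 'a l2 \<Rightarrow> 'a l2" where
  "l2_scale M a = l2_mult M (\<lambda>p. a)"

definition l2_diff :: "'a::topological_space riemannian \<Rightarrow> 'a l2 \<Rightarrow> 'a l2 \<Rightarrow> 'a l2" where
  "l2_diff M \<xi> \<zeta> = l2_add M \<xi> (l2_scale M (- 1) \<zeta>)"

definition l2_norm :: "'a::topological_space riemannian \<Rightarrow> 'a l2 \<Rightarrow> real" where
  "l2_norm M \<xi> =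
     sqrt (enn2real (\<integral>\<^sup>+ p. ennreal (form_norm2 M p (l2_rep \<xi> p)) \<partial>riem_volume M))"

definition pullback_form :: "'a riemannian \<Rightarrow> ('a \<Rightarrow> 'a) \<Rightarrow> 'a form \<Rightarrow> 'a form" where
  "pullback_form M F \<omega> = (\<lambda>p xs.
     if set xs \<subseteq> tspace M p then \<omega> (F p) (map (differential (atlas M) F) xs) else 0)"

definition l2_pullback :: "'a::topological_space riemannian \<Rightarrow> ('a \<Rightarrow> 'a) \<Rightarrow> 'a l2 \<Rightarrow> 'a l2" where
  "l2_pullback M F \<xi> = l2_class M (pullback_form M F (l2_rep \<xi>))"


section \<open>Operators\<close>

definition bounded_ops :: "'a::topological_space riemannian \<Rightarrow> ('a l2 \<Rightarrow> 'a l2) set" where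
  "bounded_ops M = {T. T \<in> L2 M \<rightarrow>\<^sub>E L2 M \<and>
     (\<forall>\<xi>\<in>L2 M. \<forall>\<zeta>\<in>L2 M. T (l2_add M \<xi> \<zeta>) = l2_add M (T \<xi>) (T \<zeta>)) \<and>
     (\<forall>a. \<forall>\<xi>\<in>L2 M. T (l2_scale M a \<xi>) = l2_scale M a (T \<xi>)) \<and>
     (\<exists>B. \<forall>\<xi>\<in>L2 M. l2_norm M (T \<xi>) \<le> B * l2_norm M \<xi>)}"

definition compact_op :: "'a::topological_space riemannian \<Rightarrow> ('a l2 \<Rightarrow> 'a l2) \<Rightarrow> bool" where
  "compact_op M K \<longleftrightarrow> K \<in> bounded_ops M \<and>
     (\<forall>\<xi> :: nat \<Rightarrow> 'a l2. (\<forall>n. \<xi> n \<in> L2 M \<and> l2_norm M (\<xi> n) \<le> 1) \<longrightarrow>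
        (\<exists>r \<zeta>. strict_mono r \<and> \<zeta> \<in> L2 M \<and>
           (\<lambda>n. l2_norm M (l2_diff M (K (\<xi> (r n))) \<zeta>)) \<longlonglongrightarrow> 0))"

definition norm_closure ::
  "'a::topological_space riemannian \<Rightarrow> ('a l2 \<Rightarrow> 'a l2) set \<Rightarrow> ('a l2 \<Rightarrow> 'a l2) set" where
  "norm_closure M \<A> = {T \<in> bounded_ops M. \<forall>e>0. \<exists>S\<in>\<A>.
     \<forall>\<xi>\<in>L2 M. l2_norm M (l2_diff M (T \<xi>) (S \<xi>)) \<le> e * l2_norm M \<xi>}"

text \<open>For an open subset \<open>U\<close>, the functions in \<open>C\<^sub>0(U)\<close> extended by \<open>0\<close> are precisely the functions
  that vanish off \<open>U\<close>, are continuous, and vanish at infinity.\<close>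

definition C0 :: "'a::topological_space set \<Rightarrow> ('a \<Rightarrow> complex) set" where
  "C0 U = {\<phi>. continuous_on UNIV \<phi> \<and> (\<forall>e>0. compact {x. e \<le> cmod (\<phi> x)}) \<and> (\<forall>x. x \<notin> U \<longrightarrow> \<phi> x = 0)}"

definition op_support ::
  "'a::topological_space riemannian \<Rightarrow> ('a l2 \<Rightarrow> 'a l2) \<Rightarrow> ('a \<times> 'a) set" where
  "op_support M T = - \<Union> {U \<times> V | U V. open U \<and> open V \<and>
     (\<forall>\<phi>\<in>C0 U. \<forall>\<psi>\<in>C0 V. \<forall>\<xi>\<in>L2 M. l2_mult M \<phi> (T (l2_mult M \<psi> \<xi>)) = l2_zero M)}"

definition pseudo_local :: "'a::topological_space riemannian \<Rightarrow> ('a l2 \<Rightarrow> 'a l2) \<Rightarrow> bool" where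
  "pseudo_local M T \<longleftrightarrow> (\<forall>\<phi>\<in>C0 UNIV. compact_op M
     (\<lambda>\<xi>\<in>L2 M. l2_diff M (l2_mult M \<phi> (T \<xi>)) (T (l2_mult M \<phi> \<xi>))))"

definition locally_compact_op :: "'a::topological_space riemannian \<Rightarrow> ('a l2 \<Rightarrow> 'a l2) \<Rightarrow> bool" where
  "locally_compact_op M T \<longleftrightarrow> (\<forall>\<phi>\<in>C0 UNIV.
     compact_op M (\<lambda>\<xi>\<in>L2 M. l2_mult M \<phi> (T \<xi>)) \<and>
     compact_op M (\<lambda>\<xi>\<in>L2 M. T (l2_mult M \<phi> \<xi>)))"

definition invariant_op ::
  "('g, 'k) monoid_scheme \<Rightarrow> 'a::topological_space riemannian \<Rightarrow> ('g \<Rightarrow> 'a \<Rightarrow> 'a) \<Rightarrow>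
   ('a l2 \<Rightarrow> 'a l2) \<Rightarrow> bool" where
  "invariant_op G M \<rho> T \<longleftrightarrow> (\<forall>\<gamma>\<in>carrier G. \<forall>\<xi>\<in>L2 M.
     T (l2_pullback M (\<rho> \<gamma>) \<xi>) = l2_pullback M (\<rho> \<gamma>) (T \<xi>))"


section \<open>Disjoint union\<close>

instantiation sum :: (topological_space, topological_space) topological_space
begin

definition open_sum :: "('a + 'b) set \<Rightarrow> bool" where
  "open_sum U \<longleftrightarrow> open (Inl -` U) \<and> open (Inr -` U)"

instance
proof
  show "open (UNIV :: ('a + 'b) set)"
    by (simp add: open_sum_def)
next
  fix S T :: "('a + 'b) set"
  assume "open S" "open T"
  then show "open (S \<inter> T)"
    by (simp add: open_sum_def vimage_Int open_Int)
next
  fix K :: "('a + 'b) set set"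
  assume "\<forall>S\<in>K. open S"
  then show "open (\<Union> K)"
    by (auto simp add: open_sum_def vimage_Union intro!: open_UN)
qed

end

text \<open>A tangent vector \<open>X\<close> of \<open>M \<squnion> N\<close> at a point of \<open>M\<close> corresponds to the tangent vector
  \<open>v \<mapsto> X (v \<squnion> 0)\<close> of \<open>M\<close>, which is the inverse of the differential of the inclusion, and
  similarly for \<open>N\<close>.\<close>

definition disjoint_union ::
  "'a riemannian \<Rightarrow> 'b riemannian \<Rightarrow> ('a + 'b) riemannian"  (infixr "\<squnion>\<^sub>R" 65) where
  "M \<squnion>\<^sub>R N = \<lparr>
     atlas =
       (\<lambda>c. \<lparr>cdim = cdim c, cdom = Inl ` cdom c, cmap = case_sum (cmap c) (\<lambda>_ _. 0)\<rparr>) ` atlas M \<union>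
       (\<lambda>c. \<lparr>cdim = cdim c, cdom = Inr ` cdom c, cmap = case_sum (\<lambda>_ _. 0) (cmap c)\<rparr>) ` atlas N,
     metr = (\<lambda>s X Y. case s of
       Inl p \<Rightarrow> metr M p (\<lambda>v. X (case_sum v (\<lambda>_. 0))) (\<lambda>v. Y (case_sum v (\<lambda>_. 0)))
     | Inr q \<Rightarrow> metr N q (\<lambda>v. X (case_sum (\<lambda>_. 0) v)) (\<lambda>v. Y (case_sum (\<lambda>_. 0) v)))\<rparr>"


section \<open>Lipschitz homotopies\<close>

definition lipschitz_wrt ::
  "'a set \<Rightarrow> ('a \<Rightarrow> 'a \<Rightarrow> real) \<Rightarrow> ('b \<Rightarrow> 'b \<Rightarrow> real) \<Rightarrow> ('a \<Rightarrow> 'b) \<Rightarrow> bool" where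
  "lipschitz_wrt S d d' F \<longleftrightarrow> (\<exists>C\<ge>0. \<forall>x\<in>S. \<forall>y\<in>S. d' (F x) (F y) \<le> C * d x y)"

definition lipschitz_map ::
  "'a::topological_space riemannian \<Rightarrow> 'b::topological_space riemannian \<Rightarrow> ('a \<Rightarrow> 'b) \<Rightarrow> bool" where
  "lipschitz_map M N F \<longleftrightarrow> lipschitz_wrt UNIV (riem_dist M) (riem_dist N) F"

definition cylinder_dist ::
  "'a::topological_space riemannian \<Rightarrow> 'a \<times> real \<Rightarrow> 'a \<times> real \<Rightarrow> real" where
  "cylinder_dist M x y = sqrt ((riem_dist M (fst x) (fst y))\<^sup>2 + (dist (snd x) (snd y))\<^sup>2)"

definition lipschitz_homotopy ::
  "'a::topological_space riemannian \<Rightarrow> 'b::topological_space riemannian \<Rightarrow>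
   ('a \<Rightarrow> 'b) \<Rightarrow> ('a \<Rightarrow> 'b) \<Rightarrow> ('a \<times> real \<Rightarrow> 'b) \<Rightarrow> bool" where
  "lipschitz_homotopy M N F F' H \<longleftrightarrow>
     lipschitz_wrt (UNIV \<times> {0..1}) (cylinder_dist M) (riem_dist N) H \<and>
     (\<forall>x. H (x, 0) = F x) \<and> (\<forall>x. H (x, 1) = F' x)"

definition lipschitz_homotopy_equivalence ::
  "'a::topological_space riemannian \<Rightarrow> 'b::topological_space riemannian \<Rightarrow> ('a \<Rightarrow> 'b) \<Rightarrow> bool" where
  "lipschitz_homotopy_equivalence M N F \<longleftrightarrow> lipschitz_map M N F \<and>
     (\<exists>F'. lipschitz_map N M F' \<and>
        (\<exists>H. lipschitz_homotopy M M (F' \<circ> F) id H) \<and>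
        (\<exists>H. lipschitz_homotopy N N (F \<circ> F') id H))"

definition equivariant ::
  "('g, 'k) monoid_scheme \<Rightarrow> ('g \<Rightarrow> 'a \<Rightarrow> 'a) \<Rightarrow> ('g \<Rightarrow> 'b \<Rightarrow> 'b) \<Rightarrow> ('a \<Rightarrow> 'b) \<Rightarrow> bool" where
  "equivariant G \<rho> \<sigma> F \<longleftrightarrow> (\<forall>\<gamma>\<in>carrier G. \<forall>x. F (\<rho> \<gamma> x) = \<sigma> \<gamma> (F x))"

definition equivariantly_lipschitz_homotopic ::
  "('g, 'k) monoid_scheme \<Rightarrow>
   'a::topological_space riemannian \<Rightarrow> ('g \<Rightarrow> 'a \<Rightarrow> 'a) \<Rightarrow>
   'b::topological_space riemannian \<Rightarrow> ('g \<Rightarrow> 'b \<Rightarrow> 'b) \<Rightarrow> ('a \<Rightarrow> 'b) \<Rightarrow> ('a \<Rightarrow> 'b) \<Rightarrow> bool" where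
  "equivariantly_lipschitz_homotopic G M \<rho> N \<sigma> F F' \<longleftrightarrow>
     equivariant G \<rho> \<sigma> F \<and> equivariant G \<rho> \<sigma> F' \<and>
     (\<exists>H. lipschitz_homotopy M N F F' H \<and>
        (\<forall>\<gamma>\<in>carrier G. \<forall>x. \<forall>t\<in>{0..1}. H (\<rho> \<gamma> x, t) = \<sigma> \<gamma> (H (x, t))))"


section \<open>Coarse structure and algebras\<close>

definition close_maps ::
  "'b::topological_space riemannian \<Rightarrow> ('a \<Rightarrow> 'b) \<Rightarrow> 's set \<Rightarrow>
   ('s \<Rightarrow> 'a + 'b) \<Rightarrow> ('s \<Rightarrow> 'a + 'b) \<Rightarrow> bool" where
  "close_maps N f S p\<^sub>1 p\<^sub>2 \<longleftrightarrow>
     (\<exists>C. \<forall>x\<in>S. riem_dist N (case_sum f id (p\<^sub>1 x)) (case_sum f id (p\<^sub>2 x)) \<le> C)"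

definition controlled_set ::
  "'b::topological_space riemannian \<Rightarrow> ('a \<Rightarrow> 'b) \<Rightarrow> (('a + 'b) \<times> ('a + 'b)) set \<Rightarrow> bool" where
  "controlled_set N f E \<longleftrightarrow> close_maps N f E fst snd"

definition controlled_op ::
  "'a::topological_space riemannian \<Rightarrow> 'b::topological_space riemannian \<Rightarrow> ('a \<Rightarrow> 'b) \<Rightarrow>
   (('a + 'b) l2 \<Rightarrow> ('a + 'b) l2) \<Rightarrow> bool" where
  "controlled_op M N f T \<longleftrightarrow> controlled_set N f (op_support (M \<squnion>\<^sub>R N) T)"

definition D_star ::
  "('g, 'k) monoid_scheme \<Rightarrow>
   'a::topological_space riemannian \<Rightarrow> ('g \<Rightarrow> 'a \<Rightarrow> 'a) \<Rightarrow>
   'b::topological_space riemannian \<Rightarrow> ('g \<Rightarrow> 'b \<Rightarrow> 'b) \<Rightarrow>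
   ('a \<Rightarrow> 'b) \<Rightarrow> (('a + 'b) l2 \<Rightarrow> ('a + 'b) l2) set" where
  "D_star G M \<rho> N \<sigma> f = norm_closure (M \<squnion>\<^sub>R N) {T \<in> bounded_ops (M \<squnion>\<^sub>R N).
     invariant_op G (M \<squnion>\<^sub>R N) (\<lambda>\<gamma>. map_sum (\<rho> \<gamma>) (\<sigma> \<gamma>)) T \<and>
     controlled_op M N f T \<and> pseudo_local (M \<squnion>\<^sub>R N) T}"

definition C_star ::
  "('g, 'k) monoid_scheme \<Rightarrow>
   'a::topological_space riemannian \<Rightarrow> ('g \<Rightarrow> 'a \<Rightarrow> 'a) \<Rightarrow>
   'b::topological_space riemannian \<Rightarrow> ('g \<Rightarrow> 'b \<Rightarrow> 'b) \<Rightarrow>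
   ('a \<Rightarrow> 'b) \<Rightarrow> (('a + 'b) l2 \<Rightarrow> ('a + 'b) l2) set" where
  "C_star G M \<rho> N \<sigma> f = norm_closure (M \<squnion>\<^sub>R N) {T \<in> bounded_ops (M \<squnion>\<^sub>R N).
     invariant_op G (M \<squnion>\<^sub>R N) (\<lambda>\<gamma>. map_sum (\<rho> \<gamma>) (\<sigma> \<gamma>)) T \<and>
     controlled_op M N f T \<and> pseudo_local (M \<squnion>\<^sub>R N) T \<and> locally_compact_op (M \<squnion>\<^sub>R N) T}"

end

theory Submission
  imports Defs
begin

text \<open>The algebras depend on \<open>f\<close> only through the controlled sets. Restricting the homotopy to
  \<open>{x} \<times> {0, 1}\<close> bounds the distance of \<open>f x\<close> and \<open>f' x\<close> uniformly in \<open>x\<close>, so \<open>f\<close> and \<open>f'\<close> have the same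
  controlled sets by the triangle inequality in \<open>N\<close>. With \<^const>\<open>riem_dist\<close> a real number, the
  triangle inequality needs that any two points of \<open>N\<close> are joined by a curve of finite length;
  locally, a path moving one chart coordinate at a time is such a curve, and its speed is given by
  the diagonal metric coefficients, so that no chain rule in several variables is required.\<close>

subsection \<open>Smooth functions and velocities\<close>

text \<open>Openness along coordinate lines, which is all that partial derivatives see. Chart images
  are open only relative to \<open>Euclidean_space n\<close>, not in the whole function
  space.\<close>

definition coord_open :: "nat \<Rightarrow> (nat \<Rightarrow> real) set \<Rightarrow> bool" where
  "coord_open n W \<longleftrightarrow> (\<forall>x\<in>W. \<forall>i<n. \<forall>\<^sub>F t in nhds (x i). x(i := t) \<in> W)"

text \<open>An open set of the product topology contains a basic product of open sets around
  \<open>x\<close>. From index \<open>n\<close> on, \<open>x\<close> and \<open>y\<close> both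
  vanish, so only finitely many factors restrict the radius.\<close>

lemma openin_Euclidean_space_box:
  assumes "openin (Euclidean_space n) W" and "x \<in> W"
  shows "\<exists>e>0. \<forall>y. (\<forall>i<n. \<bar>y i - x i\<bar> < e) \<longrightarrow> (\<forall>i\<ge>n. y i = 0) \<longrightarrow> y \<in> W"
proof -
  obtain U where U: "open U" "W = U \<inter> {x. \<forall>i\<ge>n. x i = 0}"
    using assms(1) unfolding Euclidean_space_def openin_subtopology euclidean_product_topology
    by auto
  from U(1) have "openin (product_topology (\<lambda>i::nat. euclidean :: real topology) UNIV) U"
    by (simp add: euclidean_product_topology)
  from product_topology_open_contains_basis[OF this, of x] assms(2) U(2)
  obtain X where X: "x \<in> Pi\<^sub>E UNIV X" "\<And>i. open (X i :: real set)" "Pi\<^sub>E UNIV X \<subseteq> U"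
    by auto
  have "\<exists>e>0. \<forall>t. \<bar>t - x i\<bar> < e \<longrightarrow> t \<in> X i" for i
    using X(1) X(2)[of i] by (auto simp: open_dist dist_real_def PiE_iff)
  then obtain d where d: "\<And>i. d i > 0" "\<And>i t. \<bar>t - x i\<bar> < d i \<Longrightarrow> t \<in> X i"
    by metis
  \<comment> \<open>The inserted \<open>1\<close> keeps the minimum meaningful for
    \<open>n = 0\<close>.\<close>
  define e where "e = Min (insert 1 (d ` {..<n}))"
  have e: "e > 0" "\<And>i. i < n \<Longrightarrow> e \<le> d i"
    using d(1) by (auto simp: e_def)
  show ?thesis
  proof (intro exI[of _ e] conjI allI impI e(1))
    fix y :: "nat \<Rightarrow> real"
    assume y: "\<forall>i<n. \<bar>y i - x i\<bar> < e" "\<forall>i\<ge>n. y i = 0"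
    have "y i \<in> X i" for i
    proof (cases "i < n")
      case True
      then show ?thesis using y(1) e(2) d(2) by fastforce
    next
      case False
      then have "y i = x i" using y(2) assms(2) U(2) by auto
      then show ?thesis using X(1) by (auto simp: PiE_iff)
    qed
    then show "y \<in> W" using X(3) U(2) y(2) by auto
  qed
qed

lemma coord_open_openin_Euclidean_space:
  assumes W: "openin (Euclidean_space n) W"
  shows "coord_open n W"
  unfolding coord_open_def
proof (intro ballI allI impI)
  fix x i assume x: "x \<in> W" and i: "i < n"
  obtain e where e: "e > 0"
    and box: "\<And>y. \<forall>i<n. \<bar>y i - x i\<bar> < e \<Longrightarrow> \<forall>i\<ge>n. y i = 0 \<Longrightarrow> y \<in> W"
    using openin_Euclidean_space_box[OF W x] by blast
  have x0: "x j = 0" if "j \<ge> n" for j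
    using openin_subset[OF W] x that by (auto simp: topspace_Euclidean_space)
  have "x(i := t) \<in> W" if "dist t (x i) < e" for t
    using that i e x0 by (intro box) (auto simp: dist_real_def)
  then show "\<forall>\<^sub>F t in nhds (x i). x(i := t) \<in> W"
    using e by (auto simp: eventually_nhds_metric)
qed

lemma partial_cong:
  assumes "\<forall>\<^sub>F t in nhds (x i). h (x(i := t)) = h' (x(i := t))"
  shows "partial i h x = partial i h' x"
  unfolding partial_def using assms by (rule deriv_cong_ev) simp

text \<open>On a \<open>coord_open\<close> set, functions equal on \<open>W\<close> are also equal
  near each point along coordinate lines, so their partial derivatives agree on \<open>W\<close>.
  This serves the sum and product rules, whose formulas for \<open>partial\<close> hold on
  \<open>W\<close> only.\<close>

lemma Ck_on_cong:
  assumes "coord_open n W" and "\<And>x. x \<in> W \<Longrightarrow> h x = h' x" and "Ck_on k n W h"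
  shows "Ck_on k n W h'"
  using assms(2,3)
proof (induction k arbitrary: h h')
  case 0
  then show ?case by (auto intro: continuous_on_eq)
next
  case (Suc k)
  have ev: "\<forall>\<^sub>F t in nhds (x i). h (x(i := t)) = h' (x(i := t))" if "x \<in> W" "i < n" for x i
  proof -
    have "\<forall>\<^sub>F t in nhds (x i). x(i := t) \<in> W"
      using assms(1) that by (auto simp: coord_open_def)
    then show ?thesis by eventually_elim (rule Suc.prems(1))
  qed
  have 1: "continuous_on W h'"
    using Suc.prems by (auto intro: continuous_on_eq)
  have 2: "(\<lambda>t. h' (x(i := t))) differentiable (at (x i))" if "x \<in> W" "i < n" for x i
  proof -
    have "(\<lambda>t. h (x(i := t))) differentiable (at (x i))"
      using Suc.prems(2) that by simp
    then obtain D where "((\<lambda>t. h (x(i := t))) has_field_derivative D) (at (x i))"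
      unfolding real_differentiable_def by blast
    then have "((\<lambda>t. h' (x(i := t))) has_field_derivative D) (at (x i))"
      using DERIV_cong_ev[OF refl ev[OF that] refl] by simp
    then show ?thesis unfolding real_differentiable_def by blast
  qed
  have 3: "Ck_on k n W (partial i h')" if "i < n" for i
  proof (rule Suc.IH)
    show "partial i h x = partial i h' x" if "x \<in> W" for x
      by (rule partial_cong[OF ev[OF that \<open>i < n\<close>]])
    show "Ck_on k n W (partial i h)"
      using Suc.prems(2) that by simp
  qed
  show ?case using 1 2 3 by simp
qed

lemma Ck_on_SucD: "Ck_on (Suc k) n W h \<Longrightarrow> Ck_on k n W h"
  by (induction k arbitrary: h) auto

lemma Ck_on_linear:
  assumes W: "coord_open n W" and "Ck_on k n W h" and "Ck_on k n W h'"
  shows "Ck_on k n W (\<lambda>x. a * h x + b * h' x)"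
  using assms(2,3)
proof (induction k arbitrary: h h')
  case 0
  then show ?case by (auto intro!: continuous_intros)
next
  case (Suc k)
  have d: "(\<lambda>t. h (x(i := t))) field_differentiable (at (x i))"
    "(\<lambda>t. h' (x(i := t))) field_differentiable (at (x i))" if "x \<in> W" "i < n" for x i
    using Suc.prems that by (auto simp: field_differentiable_def real_differentiable_def)
  have eq: "a * partial i h x + b * partial i h' x = partial i (\<lambda>x. a * h x + b * h' x) x"
    if "x \<in> W" "i < n" for x i
    using d[OF that] unfolding partial_def
    by (subst deriv_add) (auto intro!: field_differentiable_mult)
  have 3: "Ck_on k n W (partial i (\<lambda>x. a * h x + b * h' x))" if "i < n" for i
    using Suc.prems that by (intro Ck_on_cong[OF W eq Suc.IH]) auto
  show ?case using Suc.prems 3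
    by (auto intro!: continuous_intros derivative_intros differentiable_mult)
qed

text \<open>By the product rule a partial derivative of the product is a sum of products of a
  function with a partial derivative. Both factors are of class \<open>k\<close>, the
  undifferentiated one by \<open>Ck_on_SucD\<close>, so the induction hypothesis applies.\<close>

lemma Ck_on_mult:
  assumes W: "coord_open n W" and "Ck_on k n W h" and "Ck_on k n W h'"
  shows "Ck_on k n W (\<lambda>x. h x * h' x)"
  using assms(2,3)
proof (induction k arbitrary: h h')
  case 0
  then show ?case by (auto intro!: continuous_intros)
next
  case (Suc k)
  have d: "(\<lambda>t. h (x(i := t))) field_differentiable (at (x i))"
    "(\<lambda>t. h' (x(i := t))) field_differentiable (at (x i))" if "x \<in> W" "i < n" for x i
    using Suc.prems that by (auto simp: field_differentiable_def real_differentiable_def)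
  \<comment> \<open>The factors \<open>1\<close> give the left side the shape of the conclusion of
    \<open>Ck_on_linear\<close>.\<close>
  have eq: "1 * (h x * partial i h' x) + 1 * (partial i h x * h' x) = partial i (\<lambda>x. h x * h' x) x"
    if "x \<in> W" "i < n" for x i
    using deriv_mult[OF d[OF that]] unfolding partial_def by simp
  have 3: "Ck_on k n W (partial i (\<lambda>x. h x * h' x))" if "i < n" for i
    using Suc.prems that Ck_on_SucD[OF Suc.prems(1)] Ck_on_SucD[OF Suc.prems(2)]
    by (intro Ck_on_cong[OF W eq Ck_on_linear[OF W Suc.IH Suc.IH]]) auto
  show ?case using Suc.prems 3
    by (auto intro!: continuous_intros derivative_intros differentiable_mult)
qed

lemma chart_coord_open:
  assumes "smooth_atlas A" and "c \<in> A"
  shows "coord_open (cdim c) (cmap c ` cdom c)"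
  using assms by (auto simp: smooth_atlas_def is_chart_def intro: coord_open_openin_Euclidean_space)

lemma smooth_functions_linear:
  assumes "smooth_atlas A" and "u \<in> smooth_functions A" and "v \<in> smooth_functions A"
  shows "(\<lambda>q. a * u q + b * v q) \<in> smooth_functions A"
  using assms chart_coord_open[OF assms(1)]
  by (auto simp: smooth_functions_def smooth_on_def intro!: Ck_on_linear)

lemma smooth_functions_mult:
  assumes "smooth_atlas A" and "u \<in> smooth_functions A" and "v \<in> smooth_functions A"
  shows "(\<lambda>q. u q * v q) \<in> smooth_functions A"
  using assms chart_coord_open[OF assms(1)]
  by (auto simp: smooth_functions_def smooth_on_def intro!: Ck_on_mult)

section \<open>Velocities and speeds of curves\<close>

definition curve_differentiable :: "'a chart set \<Rightarrow> (real \<Rightarrow> 'a) \<Rightarrow> real \<Rightarrow> bool" where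
  "curve_differentiable A \<gamma> t \<longleftrightarrow>
     (\<forall>u\<in>smooth_functions A. (\<lambda>s. u (\<gamma> s)) field_differentiable (at t))"

text \<open>The derivation laws are the sum and product rules for derivatives in \<open>t\<close>.
  Smooth functions are closed under both operations, so the default value \<open>0\<close> of
  \<open>velocity\<close> does not interfere with these laws.\<close>

lemma velocity_in_tangent_space:
  assumes "smooth_atlas A" and "curve_differentiable A \<gamma> t"
  shows "velocity A \<gamma> t \<in> tangent_space A (\<gamma> t)"
proof -
  have d: "(\<lambda>s. u (\<gamma> s)) field_differentiable (at t)" if "u \<in> smooth_functions A" for u
    using assms(2) that by (simp add: curve_differentiable_def)
  have "deriv (\<lambda>s. a * u (\<gamma> s) + b * v (\<gamma> s)) t =
      a * deriv (\<lambda>s. u (\<gamma> s)) t + b * deriv (\<lambda>s. v (\<gamma> s)) t"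
    if "u \<in> smooth_functions A" "v \<in> smooth_functions A" for u v a b
    using d[OF that(1)] d[OF that(2)] by (subst deriv_add) (auto intro!: field_differentiable_mult)
  moreover have "deriv (\<lambda>s. u (\<gamma> s) * v (\<gamma> s)) t =
      u (\<gamma> t) * deriv (\<lambda>s. v (\<gamma> s)) t + v (\<gamma> t) * deriv (\<lambda>s. u (\<gamma> s)) t"
    if "u \<in> smooth_functions A" "v \<in> smooth_functions A" for u v
    using deriv_mult[OF d[OF that(1)] d[OF that(2)]] by simp
  ultimately show ?thesis
    using smooth_functions_linear[OF assms(1)] smooth_functions_mult[OF assms(1)]
    by (simp add: tangent_space_def velocity_def)
qed

definition speed :: "'a riemannian \<Rightarrow> (real \<Rightarrow> 'a) \<Rightarrow> real \<Rightarrow> real" where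
  "speed M \<gamma> t = sqrt (metr M (\<gamma> t) (velocity (atlas M) \<gamma> t) (velocity (atlas M) \<gamma> t))"

text \<open>Linearity of the metric is given in the first argument only, so symmetry brings the
  second factor \<open>m\<close> there. For this the scaled vector has to be a tangent vector as
  well.\<close>

lemma metr_scale:
  assumes "riemannian_metric A g" and X: "X \<in> tangent_space A p"
  shows "g p (\<lambda>u. m * X u) (\<lambda>u. m * X u) = m\<^sup>2 * g p X X"
proof -
  have lin: "g p (\<lambda>u. a * X u + b * Y u) Z = a * g p X Z + b * g p Y Z"
    if "X \<in> tangent_space A p" "Y \<in> tangent_space A p" "Z \<in> tangent_space A p" for X Y Z a b
    using assms(1) that unfolding riemannian_metric_def by blast
  have sym: "g p X Y = g p Y X"
    if "X \<in> tangent_space A p" "Y \<in> tangent_space A p" for X Y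
    using assms(1) that unfolding riemannian_metric_def by blast
  have mX: "(\<lambda>u. m * X u) \<in> tangent_space A p"
    using X by (auto simp: tangent_space_def algebra_simps)
  have "g p (\<lambda>u. m * X u) (\<lambda>u. m * X u) = m * g p X (\<lambda>u. m * X u)"
    using lin[OF X X mX, of m 0] by simp
  also have "g p X (\<lambda>u. m * X u) = g p (\<lambda>u. m * X u) X"
    by (rule sym[OF X mX])
  also have "\<dots> = m * g p X X"
    using lin[OF X X X, of m 0] by simp
  finally show ?thesis by (simp add: power2_eq_square)
qed

text \<open>This is the one-variable chain rule applied to each test function. Equality near
  \<open>t\<close> suffices, so it covers the halves of a joined path; \<open>m = 0\<close> covers
  constant curves.\<close>

lemma speed_reparametrize:
  assumes M: "riemannian_manifold M" and d: "curve_differentiable (atlas M) \<gamma> (m * t + k)"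
    and ev: "\<forall>\<^sub>F s in nhds t. \<gamma>' s = \<gamma> (m * s + k)"
  shows "speed M \<gamma>' t = \<bar>m\<bar> * speed M \<gamma> (m * t + k)"
proof -
  have v: "velocity (atlas M) \<gamma>' t = (\<lambda>u. m * velocity (atlas M) \<gamma> (m * t + k) u)"
  proof
    fix u
    show "velocity (atlas M) \<gamma>' t u = m * velocity (atlas M) \<gamma> (m * t + k) u"
    proof (cases "u \<in> smooth_functions (atlas M)")
      case True
      then have "((\<lambda>s. u (\<gamma> s)) has_field_derivative deriv (\<lambda>s. u (\<gamma> s)) (m * t + k)) (at (m * t + k))"
        using d by (auto simp: curve_differentiable_def field_differentiable_derivI)
      then have "((\<lambda>s. u (\<gamma> (m * s + k))) has_field_derivative deriv (\<lambda>s. u (\<gamma> s)) (m * t + k) * m) (at t)"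
        by (rule DERIV_chain2) (auto intro!: derivative_eq_intros)
      then have "deriv (\<lambda>s. u (\<gamma> (m * s + k))) t = m * deriv (\<lambda>s. u (\<gamma> s)) (m * t + k)"
        by (simp add: DERIV_imp_deriv mult.commute)
      moreover have "deriv (\<lambda>s. u (\<gamma>' s)) t = deriv (\<lambda>s. u (\<gamma> (m * s + k))) t"
        by (rule deriv_cong_ev[OF eventually_mono[OF ev]]) auto
      ultimately show ?thesis using True by (simp add: velocity_def)
    qed (simp add: velocity_def)
  qed
  have "\<gamma>' t = \<gamma> (m * t + k)"
    using ev by (rule eventually_nhds_x_imp_x)
  moreover have "velocity (atlas M) \<gamma> (m * t + k) \<in> tangent_space (atlas M) (\<gamma> (m * t + k))"
    using M d by (intro velocity_in_tangent_space) (auto simp: riemannian_manifold_def)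
  moreover have "riemannian_metric (atlas M) (metr M)"
    using M by (simp add: riemannian_manifold_def)
  ultimately show ?thesis
    unfolding speed_def v by (simp add: metr_scale real_sqrt_mult)
qed


subsection \<open>Integrals of functions not known to be measurable\<close>

text \<open>The integral is a supremum over simple functions below \<open>F\<close>. These are
  measurable, so additivity applies to each of them even if \<open>F\<close> is an arbitrary
  function, such as the speed of a curve.\<close>

lemma nn_integral_split_le:
  assumes A: "A \<in> sets M"
  shows "(\<integral>\<^sup>+ x. F x \<partial>M) \<le> (\<integral>\<^sup>+ x\<in>A. F x \<partial>M) + (\<integral>\<^sup>+ x\<in>-A. F x \<partial>M)"
  unfolding nn_integral_def[of M F]
proof (rule SUP_least)
  fix g assume "g \<in> {g. simple_function M g \<and> g \<le> F}"
  then have g: "simple_function M g" "\<And>x. g x \<le> F x" by (auto simp: le_fun_def)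
  note [measurable] = borel_measurable_simple_function[OF g(1)] A
  have "integral\<^sup>S M g = (\<integral>\<^sup>+ x. g x \<partial>M)"
    using g(1) by (simp add: nn_integral_eq_simple_integral)
  also have "\<dots> = (\<integral>\<^sup>+ x. g x * indicator A x + g x * indicator (space M - A) x \<partial>M)"
    by (rule nn_integral_cong) (auto split: split_indicator)
  also have "\<dots> = (\<integral>\<^sup>+ x\<in>A. g x \<partial>M) + (\<integral>\<^sup>+ x\<in>space M - A. g x \<partial>M)"
    by (rule nn_integral_add) auto
  also have "\<dots> \<le> (\<integral>\<^sup>+ x\<in>A. F x \<partial>M) + (\<integral>\<^sup>+ x\<in>-A. F x \<partial>M)"
    using g(2) by (intro add_mono nn_integral_mono) (auto split: split_indicator)
  finally show "integral\<^sup>S M g \<le> (\<integral>\<^sup>+ x\<in>A. F x \<partial>M) + (\<integral>\<^sup>+ x\<in>-A. F x \<partial>M)" .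
qed

text \<open>The substitution \<open>s = 2 * t + k\<close> is carried out on the simple functions
  below the integrand, which are measurable, rather than on \<open>h\<close>.\<close>

lemma nn_integral_double_le:
  fixes h :: "real \<Rightarrow> ennreal"
  shows "(\<integral>\<^sup>+ t. 2 * h (2 * t + k) \<partial>lborel) \<le> (\<integral>\<^sup>+ s. h s \<partial>lborel)"
  unfolding nn_integral_def[of lborel "\<lambda>t. 2 * h (2 * t + k)"]
proof (rule SUP_least)
  fix g assume "g \<in> {g. simple_function lborel g \<and> g \<le> (\<lambda>t. 2 * h (2 * t + k))}"
  then have g: "simple_function lborel g" "\<And>t. g t \<le> 2 * h (2 * t + k)" by (auto simp: le_fun_def)
  have m: "g \<in> borel_measurable borel"
    using borel_measurable_simple_function[OF g(1)] by simp
  \<comment> \<open>Chosen such that \<open>2 * g' (k + 2 * t) = g t\<close>; then \<open>g'\<close>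
    is a measurable minorant of \<open>h\<close>.\<close>
  define g' where "g' = (\<lambda>s. g ((s - k) / 2) / 2)"
  have m': "g' \<in> borel_measurable borel"
    unfolding g'_def using m by measurable
  have half: "2 * (a / 2) = a" for a :: ennreal
    by (simp add: ennreal_times_divide mult.commute ennreal_mult_divide_eq)
  have le: "g' s \<le> h s" for s
  proof -
    have "g' s \<le> 2 * h s / 2"
      using g(2)[of "(s - k) / 2"] unfolding g'_def
      by (intro divide_right_mono_ennreal) (simp add: field_simps del: mult_le_cancel_left)
    then show ?thesis using half[of "h s"] by (simp add: ennreal_times_divide)
  qed
  have "integral\<^sup>S lborel g = (\<integral>\<^sup>+ t. g t \<partial>lborel)"
    using g(1) by (simp add: nn_integral_eq_simple_integral)
  also have "\<dots> = (\<integral>\<^sup>+ t. 2 * g' (k + 2 * t) \<partial>lborel)"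
    by (simp add: g'_def half)
  also have "\<dots> = 2 * (\<integral>\<^sup>+ t. g' (k + 2 * t) \<partial>lborel)"
    by (intro nn_integral_cmult) (use m' in simp)
  also have "\<dots> = (\<integral>\<^sup>+ s. g' s \<partial>lborel)"
    using nn_integral_real_affine[OF m', of 2 k] by simp
  also have "\<dots> \<le> (\<integral>\<^sup>+ s. h s \<partial>lborel)"
    by (intro nn_integral_mono le)
  finally show "integral\<^sup>S lborel g \<le> (\<integral>\<^sup>+ s. h s \<partial>lborel)" .
qed


subsection \<open>Lengths of curves\<close>

lemma C1_differentiable_on_affine:
  fixes g :: "real \<Rightarrow> real"
  assumes g: "g C1_differentiable_on S" and sub: "\<And>t. t \<in> A \<Longrightarrow> m * t + k \<in> S" and m: "m \<noteq> 0"
  shows "(\<lambda>t. g (m * t + k)) C1_differentiable_on A"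
proof -
  \<comment> \<open>\<open>C1_differentiable_compose\<close> asks for finite fibres of the inner
    map; since \<open>m\<close> is nonzero, they have at most one point.\<close>
  have "finite (A \<inter> (\<lambda>t. m * t + k) -` {x})" for x
  proof (rule finite_subset)
    show "A \<inter> (\<lambda>t. m * t + k) -` {x} \<subseteq> {(x - k) / m}"
      using m by (auto simp: field_simps)
  qed simp
  moreover have "g C1_differentiable_on ((\<lambda>t. m * t + k) ` A)"
    using g by (rule C1_differentiable_on_subset) (use sub in auto)
  moreover have "(\<lambda>t. m * t + k) C1_differentiable_on A"
    by simp
  ultimately have "(g \<circ> (\<lambda>t. m * t + k)) C1_differentiable_on A"
    by (intro C1_differentiable_compose)
  then show ?thesis by (simp add: o_def)
qed

text \<open>Derivatives are local and two-sided, so on an open set \<open>h\<close> inherits them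
  from the function it agrees with there. Continuity of the derivative on two open sets glues to
  their union. The two sets will be the halves of a joined path.\<close>

lemma C1_differentiable_on_open_Un_cong:
  fixes g :: "real \<Rightarrow> real"
  assumes "open A" "open B" and "\<And>t. t \<in> A \<Longrightarrow> h t = g\<^sub>1 t" "\<And>t. t \<in> B \<Longrightarrow> h t = g\<^sub>2 t"
    and "g\<^sub>1 C1_differentiable_on A" "g\<^sub>2 C1_differentiable_on B"
  shows "h C1_differentiable_on (A \<union> B)"
proof -
  have *: "(\<forall>x\<in>A. h differentiable at x) \<and> continuous_on A (\<lambda>x. vector_derivative h (at x))"
    if "open A" and eq: "\<And>t. t \<in> A \<Longrightarrow> h t = g t" and g: "g C1_differentiable_on A" for g A
  proof -
    from g obtain D where D: "\<And>x. x \<in> A \<Longrightarrow> (g has_vector_derivative D x) (at x)" "continuous_on A D"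
      by (auto simp: C1_differentiable_on_def)
    have h: "(h has_vector_derivative D x) (at x)" if "x \<in> A" for x
      using D(1)[OF that] \<open>open A\<close> that
      by (rule has_vector_derivative_transform_within_open) (simp add: eq)
    have "h differentiable at x" if "x \<in> A" for x
      using h[OF that] by (rule differentiableI_vector)
    moreover have "continuous_on A (\<lambda>x. vector_derivative h (at x))"
      using D(2) by (rule continuous_on_eq) (simp add: vector_derivative_at[OF h])
    ultimately show ?thesis by blast
  qed
  show ?thesis
    unfolding C1_differentiable_on_eq
    using *[OF assms(1,3,5)] *[OF assms(2,4,6)] assms(1,2) by (auto intro: continuous_on_open_Un)
qed

lemma curve_length_speed:
  "curve_length M \<gamma> = (\<integral>\<^sup>+ t \<in> {0..1}. ennreal (speed M \<gamma> t) \<partial>lborel)"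
  by (simp add: curve_length_def speed_def)

lemma piecewise_C1_curve_differentiable:
  assumes "piecewise_C1_curve A \<gamma>"
  obtains S where "finite S" "\<And>u. u \<in> smooth_functions A \<Longrightarrow> (\<lambda>t. u (\<gamma> t)) C1_differentiable_on ({0..1} - S)"
    "\<And>t. t \<in> {0..1} - S \<Longrightarrow> curve_differentiable A \<gamma> t"
proof -
  from assms obtain S where S: "finite S"
      "\<And>u. u \<in> smooth_functions A \<Longrightarrow> (\<lambda>t. u (\<gamma> t)) C1_differentiable_on ({0..1} - S)"
    by (auto simp: piecewise_C1_curve_def)
  moreover have "curve_differentiable A \<gamma> t" if "t \<in> {0..1} - S" for t
    using S(2) that
    by (auto simp: curve_differentiable_def C1_differentiable_on_eq field_differentiable_def
        real_differentiable_def)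
  ultimately show thesis by (rule that)
qed

text \<open>Each half runs through one of the curves at double speed, so the factor \<open>2\<close>
  in the speed cancels against the substitution in the integral.\<close>

lemma piecewise_C1_curve_join:
  assumes M: "riemannian_manifold M"
    and \<gamma>\<^sub>1: "piecewise_C1_curve (atlas M) \<gamma>\<^sub>1" and \<gamma>\<^sub>2: "piecewise_C1_curve (atlas M) \<gamma>\<^sub>2"
    and j: "\<gamma>\<^sub>1 1 = \<gamma>\<^sub>2 0"
  shows "piecewise_C1_curve (atlas M) (\<gamma>\<^sub>1 +++ \<gamma>\<^sub>2)"
    and "curve_length M (\<gamma>\<^sub>1 +++ \<gamma>\<^sub>2) \<le> curve_length M \<gamma>\<^sub>1 + curve_length M \<gamma>\<^sub>2"
proof -
  obtain S\<^sub>1 where S1: "finite S\<^sub>1"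
      "\<And>u. u \<in> smooth_functions (atlas M) \<Longrightarrow> (\<lambda>t. u (\<gamma>\<^sub>1 t)) C1_differentiable_on ({0..1} - S\<^sub>1)"
      "\<And>t. t \<in> {0..1} - S\<^sub>1 \<Longrightarrow> curve_differentiable (atlas M) \<gamma>\<^sub>1 t"
    using piecewise_C1_curve_differentiable[OF \<gamma>\<^sub>1] by blast
  obtain S\<^sub>2 where S2: "finite S\<^sub>2"
      "\<And>u. u \<in> smooth_functions (atlas M) \<Longrightarrow> (\<lambda>t. u (\<gamma>\<^sub>2 t)) C1_differentiable_on ({0..1} - S\<^sub>2)"
      "\<And>t. t \<in> {0..1} - S\<^sub>2 \<Longrightarrow> curve_differentiable (atlas M) \<gamma>\<^sub>2 t"
    using piecewise_C1_curve_differentiable[OF \<gamma>\<^sub>2] by blast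
  \<comment> \<open>The exceptional parameters of both curves, transported to the halves, together
    with the endpoints and the junction. Off \<open>T\<close> the joined path is locally given by a
    single formula, and what remains of each half is open.\<close>
  define T where "T = {0, 1/2, 1} \<union> (\<lambda>s. s / 2) ` S\<^sub>1 \<union> (\<lambda>s. (s + 1) / 2) ` S\<^sub>2"
  define A where "A = {0<..<1/2} - T"
  define B where "B = {1/2<..<1} - T"
  have T: "finite T" using S1(1) S2(1) by (simp add: T_def)
  have open_AB: "open A" "open B"
    unfolding A_def B_def using T by (auto intro!: open_Diff finite_imp_closed)
  have AB: "{0..1} - T = A \<union> B"
    by (auto simp: A_def B_def T_def)
  have A: "2 * t + 0 \<in> {0..1} - S\<^sub>1" if "t \<in> A" for t
  proof -
    have "2 * t \<notin> S\<^sub>1"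
    proof
      assume "2 * t \<in> S\<^sub>1"
      then have "2 * t / 2 \<in> T" unfolding T_def by blast
      then show False using that by (simp add: A_def)
    qed
    then show ?thesis using that by (auto simp: A_def)
  qed
  have B: "2 * t + -1 \<in> {0..1} - S\<^sub>2" if "t \<in> B" for t
  proof -
    have "2 * t - 1 \<notin> S\<^sub>2"
    proof
      assume "2 * t - 1 \<in> S\<^sub>2"
      then have "((2 * t - 1) + 1) / 2 \<in> T" unfolding T_def by blast
      then show False using that by (simp add: B_def)
    qed
    then show ?thesis using that by (auto simp: B_def)
  qed
  have jA: "(\<gamma>\<^sub>1 +++ \<gamma>\<^sub>2) t = \<gamma>\<^sub>1 (2 * t + 0)" if "t \<in> A" for t
    using that by (simp add: A_def joinpaths_def)
  have jB: "(\<gamma>\<^sub>1 +++ \<gamma>\<^sub>2) t = \<gamma>\<^sub>2 (2 * t + -1)" if "t \<in> B" for t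
    using that by (simp add: B_def joinpaths_def)
  have "continuous_on {0..1} (\<gamma>\<^sub>1 +++ \<gamma>\<^sub>2)"
    using path_join[of \<gamma>\<^sub>1 \<gamma>\<^sub>2] \<gamma>\<^sub>1 \<gamma>\<^sub>2 j
    by (simp add: piecewise_C1_curve_def path_def pathfinish_def pathstart_def)
  moreover have "(\<lambda>t. u ((\<gamma>\<^sub>1 +++ \<gamma>\<^sub>2) t)) C1_differentiable_on ({0..1} - T)"
    if u: "u \<in> smooth_functions (atlas M)" for u
    unfolding AB using open_AB
  proof (rule C1_differentiable_on_open_Un_cong)
    show "(\<lambda>t. u (\<gamma>\<^sub>1 (2 * t + 0))) C1_differentiable_on A"
      using C1_differentiable_on_affine[OF S1(2)[OF u], of A 2 0] A by simp
    show "(\<lambda>t. u (\<gamma>\<^sub>2 (2 * t + -1))) C1_differentiable_on B"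
      using C1_differentiable_on_affine[OF S2(2)[OF u], of B 2 "-1"] B by simp
  qed (simp_all only: jA jB)
  ultimately show "piecewise_C1_curve (atlas M) (\<gamma>\<^sub>1 +++ \<gamma>\<^sub>2)"
    using T unfolding piecewise_C1_curve_def by blast

  have sA: "speed M (\<gamma>\<^sub>1 +++ \<gamma>\<^sub>2) t = 2 * speed M \<gamma>\<^sub>1 (2 * t + 0)" if "t \<in> A" for t
  proof -
    have "\<forall>\<^sub>F s in nhds t. (\<gamma>\<^sub>1 +++ \<gamma>\<^sub>2) s = \<gamma>\<^sub>1 (2 * s + 0)"
      using eventually_nhds_in_open[OF open_AB(1) that] by (rule eventually_mono) (rule jA)
    from speed_reparametrize[OF M S1(3)[OF A[OF that]] this] show ?thesis by simp
  qed
  have sB: "speed M (\<gamma>\<^sub>1 +++ \<gamma>\<^sub>2) t = 2 * speed M \<gamma>\<^sub>2 (2 * t + -1)" if "t \<in> B" for t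
  proof -
    have "\<forall>\<^sub>F s in nhds t. (\<gamma>\<^sub>1 +++ \<gamma>\<^sub>2) s = \<gamma>\<^sub>2 (2 * s + -1)"
      using eventually_nhds_in_open[OF open_AB(2) that] by (rule eventually_mono) (rule jB)
    from speed_reparametrize[OF M S2(3)[OF B[OF that]] this] show ?thesis by simp
  qed
  define h\<^sub>1 where "h\<^sub>1 = (\<lambda>s. ennreal (speed M \<gamma>\<^sub>1 s) * indicator {0..1} s)"
  define h\<^sub>2 where "h\<^sub>2 = (\<lambda>s. ennreal (speed M \<gamma>\<^sub>2 s) * indicator {0..1} s)"
  have tw: "ennreal (2 * x) = 2 * ennreal x" for x :: real
    using ennreal_mult'[of 2 x] by simp
  \<comment> \<open>A majorant of the integrand off \<open>T\<close>. As \<open>h\<^sub>1\<close>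
    and \<open>h\<^sub>2\<close> vanish outside the unit interval, the substitution can be made over
    the whole real line.\<close>
  define H where "H = (\<lambda>t::real. if t \<in> {..1/2} then 2 * h\<^sub>1 (2 * t + 0) else 2 * h\<^sub>2 (2 * t + -1))"
  have "AE t in lborel. t \<notin> T"
    using T by (intro AE_not_in countable_imp_null_set_lborel) (simp add: countable_finite)
  then have "AE t in lborel.
      ennreal (speed M (\<gamma>\<^sub>1 +++ \<gamma>\<^sub>2) t) * indicator {0..1} t \<le> H t"
  proof eventually_elim
    fix t assume t: "t \<notin> T"
    consider "t \<notin> {0..1}" | "t \<in> A" | "t \<in> B" using t AB by blast
    then show "ennreal (speed M (\<gamma>\<^sub>1 +++ \<gamma>\<^sub>2) t) * indicator {0..1} t \<le> H t"
    proof cases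
      case 2
      then have "2 * t + 0 \<in> {0..1}" "t \<in> {..1/2}" using A by (auto simp: A_def)
      with 2 show ?thesis
        by (simp add: H_def h\<^sub>1_def sA tw split: split_indicator)
    next
      case 3
      then have "2 * t + -1 \<in> {0..1}" "t \<notin> {..1/2}" using B by (auto simp: B_def)
      with 3 show ?thesis
        by (simp add: H_def h\<^sub>2_def sB tw split: split_indicator)
    qed simp
  qed
  then have "curve_length M (\<gamma>\<^sub>1 +++ \<gamma>\<^sub>2) \<le> (\<integral>\<^sup>+ t. H t \<partial>lborel)"
    unfolding curve_length_speed by (rule nn_integral_mono_AE)
  also have "\<dots> \<le> (\<integral>\<^sup>+ t\<in>{..1/2}. H t \<partial>lborel) + (\<integral>\<^sup>+ t\<in>-{..1/2}. H t \<partial>lborel)"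
    by (rule nn_integral_split_le) simp
  also have "\<dots> \<le> (\<integral>\<^sup>+ t. 2 * h\<^sub>1 (2 * t + 0) \<partial>lborel) + (\<integral>\<^sup>+ t. 2 * h\<^sub>2 (2 * t + -1) \<partial>lborel)"
    by (intro add_mono nn_integral_mono) (auto simp: H_def split: split_indicator)
  also have "\<dots> \<le> (\<integral>\<^sup>+ t. h\<^sub>1 t \<partial>lborel) + (\<integral>\<^sup>+ t. h\<^sub>2 t \<partial>lborel)"
    by (intro add_mono nn_integral_double_le)
  finally show "curve_length M (\<gamma>\<^sub>1 +++ \<gamma>\<^sub>2) \<le> curve_length M \<gamma>\<^sub>1 + curve_length M \<gamma>\<^sub>2"
    by (simp add: curve_length_speed h\<^sub>1_def h\<^sub>2_def)
qed

lemma constant_curve: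
  assumes M: "riemannian_manifold M"
  shows "piecewise_C1_curve (atlas M) (\<lambda>t. p)" and "curve_length M (\<lambda>t. p) = 0"
proof -
  show "piecewise_C1_curve (atlas M) (\<lambda>t. p)"
    by (auto simp: piecewise_C1_curve_def)
  \<comment> \<open>A constant curve is its own reparametrization with \<open>m = 0\<close>, so its
    speed gets the factor \<open>0\<close>.\<close>
  have "speed M (\<lambda>t. p) t = \<bar>0\<bar> * speed M (\<lambda>t. p) (0 * t + 0)" for t
    by (rule speed_reparametrize[OF M]) (auto simp: curve_differentiable_def)
  then show "curve_length M (\<lambda>t. p) = 0"
    by (simp add: curve_length_speed)
qed

text \<open>Along a coordinate line the velocity is a multiple of \<open>coord_vector\<close>. The
  speed is therefore a multiple of the square root of a diagonal metric coefficient, which is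
  continuous and hence bounded on the compact segment.\<close>

lemma coordinate_line_curve:
  assumes M: "riemannian_manifold M" and c: "c \<in> atlas M" and i: "i < cdim c"
    and line: "\<And>t. t \<in> {0..1} \<Longrightarrow> x(i := (b - a) * t + a) \<in> cmap c ` cdom c"
  defines "\<gamma> \<equiv> \<lambda>t. cinv c (x(i := (b - a) * t + a))"
  shows "piecewise_C1_curve (atlas M) \<gamma>" and "curve_length M \<gamma> < \<infinity>"
proof -
  define W where "W = cmap c ` cdom c"
  have chart: "is_chart c"
    using M c by (auto simp: riemannian_manifold_def smooth_atlas_def)
  have cont_line: "continuous_on {0..1} (\<lambda>t. x(i := (b - a) * t + a))"
  proof (rule continuous_on_coordinatewise_then_product)
    fix j
    show "continuous_on {0..1} (\<lambda>t. (x(i := (b - a) * t + a)) j)"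
      by (cases "j = i") (auto intro!: continuous_intros)
  qed
  have cont_comp: "continuous_on {0..1} (\<lambda>t. h (x(i := (b - a) * t + a)))"
    if "continuous_on W h" for h :: "(nat \<Rightarrow> real) \<Rightarrow> 'z::topological_space"
    using line by (intro continuous_on_compose2[OF that cont_line]) (auto simp: W_def)
  have "continuous_on W (cinv c)"
    using chart by (auto simp: is_chart_def homeomorphism_def W_def)
  from cont_comp[OF this] have cont: "continuous_on {0..1} \<gamma>"
    by (simp add: \<gamma>_def)
  have der: "((\<lambda>s. u (cinv c (x(i := s)))) has_field_derivative
       partial i (\<lambda>y. u (cinv c y)) (x(i := s))) (at s)"
    if u: "u \<in> smooth_functions (atlas M)" and s: "x(i := s) \<in> W" for u s
  proof -
    have "Ck_on (Suc 0) (cdim c) W (\<lambda>y. u (cinv c y))"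
      using u c unfolding W_def smooth_functions_def smooth_on_def by blast
    then have "(\<lambda>t. u (cinv c ((x(i := s))(i := t)))) differentiable (at ((x(i := s)) i))"
      using i s unfolding Ck_on.simps by blast
    then have "(\<lambda>t. u (cinv c (x(i := t)))) field_differentiable (at s)"
      by (simp add: field_differentiable_def real_differentiable_def)
    then show ?thesis
      by (simp add: partial_def field_differentiable_derivI)
  qed
  have cd: "curve_differentiable (atlas M) (\<lambda>s. cinv c (x(i := s))) s" if "x(i := s) \<in> W" for s
    using der that by (auto simp: curve_differentiable_def field_differentiable_def)
  have "(\<lambda>t. u (\<gamma> t)) C1_differentiable_on {0..1}" if u: "u \<in> smooth_functions (atlas M)" for u
    unfolding C1_differentiable_on_def
  proof (intro exI conjI ballI)
    fix t :: real assume "t \<in> {0..1}"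
    then have "x(i := (b - a) * t + a) \<in> W" using line by (simp add: W_def)
    from der[OF u this]
    have "((\<lambda>t. u (\<gamma> t)) has_field_derivative
        partial i (\<lambda>y. u (cinv c y)) (x(i := (b - a) * t + a)) * (b - a)) (at t)"
      unfolding \<gamma>_def by (rule DERIV_chain2) (auto intro!: derivative_eq_intros)
    then show "((\<lambda>t. u (\<gamma> t)) has_vector_derivative
        partial i (\<lambda>y. u (cinv c y)) (x(i := (b - a) * t + a)) * (b - a)) (at t)"
      by (simp add: has_real_derivative_iff_has_vector_derivative)
  next
    have "Ck_on (Suc 0) (cdim c) W (\<lambda>y. u (cinv c y))"
      using u c unfolding W_def smooth_functions_def smooth_on_def by blast
    then have "continuous_on W (partial i (\<lambda>y. u (cinv c y)))"
      using i by simp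
    from cont_comp[OF this]
    show "continuous_on {0..1}
        (\<lambda>t. partial i (\<lambda>y. u (cinv c y)) (x(i := (b - a) * t + a)) * (b - a))"
      by (intro continuous_intros)
  qed
  \<comment> \<open>No parameter is exceptional, not even \<open>0\<close> or \<open>1\<close>:
    \<open>Ck_on\<close> provides two-sided derivatives at every point of \<open>W\<close>.\<close>
  then show "piecewise_C1_curve (atlas M) \<gamma>"
    using cont unfolding piecewise_C1_curve_def by (intro conjI exI[of _ "{}"]) auto

  define g where "g = (\<lambda>y. metr M (cinv c y) (coord_vector (atlas M) c i (cinv c y))
    (coord_vector (atlas M) c i (cinv c y)))"
  have "Ck_on 0 (cdim c) W g"
    using M c i unfolding riemannian_manifold_def riemannian_metric_def smooth_on_def W_def g_def
    by blast
  then have "continuous_on W g" by simp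
  from cont_comp[OF this]
  have "continuous_on {0..1} (\<lambda>t. \<bar>b - a\<bar> * sqrt (g (x(i := (b - a) * t + a))))"
    by (intro continuous_intros)
  then have "compact ((\<lambda>t. \<bar>b - a\<bar> * sqrt (g (x(i := (b - a) * t + a)))) ` {0..1})"
    by (rule compact_continuous_image) simp
  then have "bounded ((\<lambda>t. \<bar>b - a\<bar> * sqrt (g (x(i := (b - a) * t + a)))) ` {0..1})"
    by (rule compact_imp_bounded)
  then obtain L where
    "\<forall>t\<in>{0..1}. norm (\<bar>b - a\<bar> * sqrt (g (x(i := (b - a) * t + a)))) \<le> L"
    unfolding bounded_iff by blast
  then have L: "\<bar>b - a\<bar> * sqrt (g (x(i := (b - a) * t + a))) \<le> L" if "t \<in> {0..1}" for t
    using that abs_le_D1 by (metis real_norm_def)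
  have sp: "speed M \<gamma> t = \<bar>b - a\<bar> * sqrt (g (x(i := (b - a) * t + a)))" if t: "t \<in> {0..1}" for t
  proof -
    define z where "z = x(i := (b - a) * t + a)"
    have z: "z \<in> W" using line[OF t] by (simp add: W_def z_def)
    then have "cmap c (cinv c z) = z"
      unfolding W_def cinv_def by (rule f_inv_into_f)
    \<comment> \<open>Both sides differentiate the same function of the \<open>i\<close>-th
      coordinate, at the point \<open>z = cmap c (cinv c z)\<close>, and both have the default value
      \<open>0\<close> on functions that are not smooth.\<close>
    then have "velocity (atlas M) (\<lambda>s. cinv c (x(i := s))) ((b - a) * t + a) =
        coord_vector (atlas M) c i (cinv c z)"
      by (intro ext) (simp add: velocity_def coord_vector_def partial_def z_def)
    then have "speed M (\<lambda>s. cinv c (x(i := s))) ((b - a) * t + a) = sqrt (g z)"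
      by (simp add: speed_def g_def z_def)
    moreover have "speed M \<gamma> t = \<bar>b - a\<bar> * speed M (\<lambda>s. cinv c (x(i := s))) ((b - a) * t + a)"
      using z by (intro speed_reparametrize[OF M cd]) (auto simp: \<gamma>_def z_def)
    ultimately show ?thesis by (simp add: z_def)
  qed
  have "curve_length M \<gamma> \<le> (\<integral>\<^sup>+ t. ennreal L * indicator {0..1::real} t \<partial>lborel)"
    unfolding curve_length_speed
    by (intro nn_integral_mono) (auto simp: sp L intro!: ennreal_leI split: split_indicator)
  also have "\<dots> = ennreal L"
    by (simp add: nn_integral_cmult_indicator)
  finally show "curve_length M \<gamma> < \<infinity>"
    by (simp add: le_less_trans)
qed


subsection \<open>The Riemannian distance\<close>

text \<open>The infimum inside \<open>riem_dist\<close>, kept in \<open>ennreal\<close>: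
  \<open>enn2real\<close> would turn an infinite distance into \<open>0\<close>, whereas here the
  triangle inequality holds without connectedness.\<close>

definition length_dist :: "'a::topological_space riemannian \<Rightarrow> 'a \<Rightarrow> 'a \<Rightarrow> ennreal" where
  "length_dist M p q =
     (INF \<gamma> \<in> {\<gamma>. piecewise_C1_curve (atlas M) \<gamma> \<and> \<gamma> 0 = p \<and> \<gamma> 1 = q}. curve_length M \<gamma>)"

lemma length_dist_le:
  "piecewise_C1_curve (atlas M) \<gamma> \<Longrightarrow> length_dist M (\<gamma> 0) (\<gamma> 1) \<le> curve_length M \<gamma>"
  unfolding length_dist_def by (rule INF_lower) simp

lemma length_dist_refl: "riemannian_manifold M \<Longrightarrow> length_dist M p p = 0"
  using length_dist_le[OF constant_curve(1)] constant_curve(2) by (metis le_zero_eq)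

text \<open>Joining curves whose lengths exceed the two infima by at most \<open>e / 2\<close> gives
  a competitor for the distance from \<open>p\<close> to \<open>r\<close>.\<close>

lemma length_dist_triangle:
  assumes M: "riemannian_manifold M"
  shows "length_dist M p r \<le> length_dist M p q + length_dist M q r"
proof (rule ennreal_le_epsilon)
  fix e :: real
  assume fin: "length_dist M p q + length_dist M q r < top_class.top" and e: "0 < e"
  have *: "\<exists>\<gamma>. piecewise_C1_curve (atlas M) \<gamma> \<and> \<gamma> 0 = p \<and> \<gamma> 1 = q \<and>
      curve_length M \<gamma> \<le> length_dist M p q + ennreal (e / 2)" if "length_dist M p q < \<infinity>" for p q
  proof -
    \<comment> \<open>The infimum need not be attained; a strictly larger bound, available because
      the distance is finite, yields a curve.\<close>
    have "length_dist M p q < length_dist M p q + ennreal (e / 2)"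
      using that e by (cases "length_dist M p q") (auto simp flip: ennreal_plus simp: ennreal_less_iff)
    then have "\<exists>\<gamma>\<in>{\<gamma>. piecewise_C1_curve (atlas M) \<gamma> \<and> \<gamma> 0 = p \<and> \<gamma> 1 = q}.
        curve_length M \<gamma> < length_dist M p q + ennreal (e / 2)"
      by (subst (asm) length_dist_def) (simp only: INF_less_iff)
    then show ?thesis by (auto intro: less_imp_le)
  qed
  obtain \<gamma>\<^sub>1 \<gamma>\<^sub>2 where \<gamma>: "piecewise_C1_curve (atlas M) \<gamma>\<^sub>1" "\<gamma>\<^sub>1 0 = p" "\<gamma>\<^sub>1 1 = q"
      "curve_length M \<gamma>\<^sub>1 \<le> length_dist M p q + ennreal (e / 2)"
      "piecewise_C1_curve (atlas M) \<gamma>\<^sub>2" "\<gamma>\<^sub>2 0 = q" "\<gamma>\<^sub>2 1 = r"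
      "curve_length M \<gamma>\<^sub>2 \<le> length_dist M q r + ennreal (e / 2)"
    using *[of p q] *[of q r] fin by auto
  have "length_dist M p r \<le> curve_length M (\<gamma>\<^sub>1 +++ \<gamma>\<^sub>2)"
    using length_dist_le[OF piecewise_C1_curve_join(1)[OF M \<gamma>(1,5)]] \<gamma>
    by (simp add: joinpaths_def)
  also have "\<dots> \<le> curve_length M \<gamma>\<^sub>1 + curve_length M \<gamma>\<^sub>2"
    using piecewise_C1_curve_join(2)[OF M \<gamma>(1,5)] \<gamma> by simp
  also have "\<dots> \<le> (length_dist M p q + ennreal (e / 2)) + (length_dist M q r + ennreal (e / 2))"
    using \<gamma> by (intro add_mono)
  also have "\<dots> = length_dist M p q + length_dist M q r + (ennreal (e / 2) + ennreal (e / 2))"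
    by (simp add: ac_simps)
  also have "ennreal (e / 2) + ennreal (e / 2) = ennreal e"
    using e by (simp flip: ennreal_plus)
  finally show "length_dist M p r \<le> length_dist M p q + length_dist M q r + ennreal e" .
qed

section \<open>Finiteness of the distance on a connected manifold\<close>

lemma length_dist_finite_box:
  assumes M: "riemannian_manifold M" and c: "c \<in> atlas M"
    and box: "\<And>y. \<forall>i<cdim c. \<bar>y i - z i\<bar> < e \<Longrightarrow> \<forall>i\<ge>cdim c. y i = 0 \<Longrightarrow>
      y \<in> cmap c ` cdom c"
    and x: "\<And>i. i < cdim c \<Longrightarrow> \<bar>x i - z i\<bar> < e" "\<And>i. i \<ge> cdim c \<Longrightarrow> x i = 0"
    and y: "\<And>i. i < cdim c \<Longrightarrow> \<bar>y i - z i\<bar> < e" "\<And>i. i \<ge> cdim c \<Longrightarrow> y i = 0"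
  shows "length_dist M (cinv c x) (cinv c y) < \<infinity>"
proof -
  \<comment> \<open>The corners of a route from \<open>x\<close> to \<open>y\<close> that changes
    one coordinate at a time; the box is a product of intervals, so the route stays inside
    it.\<close>
  define w where "w k = (\<lambda>i. if i < k then y i else x i)" for k :: nat
  have "length_dist M (cinv c x) (cinv c (w k)) < \<infinity>" if "k \<le> cdim c" for k
    using that
  proof (induction k)
    case 0
    then show ?case by (simp add: w_def length_dist_refl[OF M])
  next
    case (Suc k)
    have line: "(w k)(k := (y k - x k) * t + x k) \<in> cmap c ` cdom c" if t: "t \<in> {0..1}" for t
    proof (rule box, intro allI impI)
      fix i assume i: "i < cdim c"
      have "\<bar>(y k - x k) * t + x k - z k\<bar> < e"
      proof -
        \<comment> \<open>The moving coordinate is a convex combination of \<open>x k\<close> and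
          \<open>y k\<close>, which both lie in the interval of radius \<open>e\<close> about
          \<open>z k\<close>.\<close>
        have "(1 - t) *\<^sub>R x k + t *\<^sub>R y k \<in> ball (z k) e"
          using t x(1)[of k] y(1)[of k] Suc.prems
          by (intro convexD[OF convex_ball]) (auto simp: dist_real_def abs_minus_commute)
        then show ?thesis by (simp add: dist_real_def abs_minus_commute algebra_simps)
      qed
      then show "\<bar>((w k)(k := (y k - x k) * t + x k)) i - z i\<bar> < e"
        using x(1) y(1) i by (auto simp: w_def)
    qed (use Suc.prems x(2) y(2) in \<open>auto simp: w_def\<close>)
    have "(w k)(k := x k) = w k" "(w k)(k := y k) = w (Suc k)"
      by (auto simp: w_def fun_eq_iff less_Suc_eq)
    then have "length_dist M (cinv c (w k)) (cinv c (w (Suc k))) < \<infinity>"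
      using coordinate_line_curve[OF M c _ line] Suc.prems
        length_dist_le[OF coordinate_line_curve(1)[OF M c _ line]]
      by (simp add: le_less_trans)
    moreover have "length_dist M (cinv c x) (cinv c (w k)) < \<infinity>"
      using Suc by simp
    ultimately show ?case
      using length_dist_triangle[OF M, of "cinv c x" "cinv c (w (Suc k))" "cinv c (w k)"]
      by (auto simp: le_less_trans)
  qed
  moreover have "w (cdim c) = y"
    using x(2) y(2) by (auto simp: w_def fun_eq_iff)
  ultimately show ?thesis by fastforce
qed

lemma length_dist_locally_finite:
  assumes M: "riemannian_manifold M"
  obtains V where "open V" "p \<in> V" "\<And>q r. q \<in> V \<Longrightarrow> r \<in> V \<Longrightarrow> length_dist M q r < \<infinity>"
proof -
  have "p \<in> (\<Union>c\<in>atlas M. cdom c)"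
    using M by (simp add: riemannian_manifold_def smooth_atlas_def)
  then obtain c where c: "c \<in> atlas M" "p \<in> cdom c"
    by blast
  have chart: "is_chart c"
    using M c by (auto simp: riemannian_manifold_def smooth_atlas_def)
  define W where "W = cmap c ` cdom c"
  define z where "z = cmap c p"
  have W: "openin (Euclidean_space (cdim c)) W" "open (cdom c)" "continuous_on (cdom c) (cmap c)"
      "\<And>q. q \<in> cdom c \<Longrightarrow> cinv c (cmap c q) = q"
    using chart by (auto simp: is_chart_def homeomorphism_def W_def)
  have "z \<in> W" using c(2) by (simp add: W_def z_def)
  obtain e where e: "e > 0" and box:
    "\<And>y. \<forall>i<cdim c. \<bar>y i - z i\<bar> < e \<Longrightarrow> \<forall>i\<ge>cdim c. y i = 0 \<Longrightarrow> y \<in> W"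
    using openin_Euclidean_space_box[OF W(1) \<open>z \<in> W\<close>] by blast
  \<comment> \<open>The preimage of the box under the chart. The last intersection with
    \<open>cdom c\<close> matters in dimension \<open>0\<close>, where the indexed intersection is
    everything.\<close>
  define V where "V = (\<Inter>i<cdim c. cdom c \<inter> (\<lambda>q. cmap c q i) -` ball (z i) e) \<inter> cdom c"
  have "open (cdom c \<inter> (\<lambda>q. cmap c q i) -` ball (z i) e)" for i
    by (rule continuous_open_preimage[OF continuous_on_product_then_coordinatewise[OF W(3)] W(2) open_ball])
  then have "open V"
    unfolding V_def using W(2) by (intro open_Int open_INT) auto
  moreover have "p \<in> V"
    using c(2) e by (simp add: V_def z_def)
  moreover have "length_dist M q r < \<infinity>" if "q \<in> V" "r \<in> V" for q r
  proof -
    have V: "q \<in> cdom c" "\<And>i. i < cdim c \<Longrightarrow> \<bar>cmap c q i - z i\<bar> < e"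
      "\<And>i. i \<ge> cdim c \<Longrightarrow> cmap c q i = 0" if "q \<in> V" for q
      using that openin_subset[OF W(1)]
      by (auto simp: V_def W_def dist_real_def abs_minus_commute topspace_Euclidean_space
          simp del: INT_simps split: if_splits)
    have "length_dist M (cinv c (cmap c q)) (cinv c (cmap c r)) < \<infinity>"
      by (rule length_dist_finite_box[OF M c(1) box[unfolded W_def]])
        (use V(2,3) that in auto)
    then show ?thesis using W(4) V(1) that by simp
  qed
  ultimately show thesis by (rule that)
qed

text \<open>The points at finite distance from \<open>p\<close> form a nonempty set that is open and
  closed, by local finiteness and the triangle inequality.\<close>

lemma length_dist_finite:
  fixes M :: "'a::topological_space riemannian"
  assumes M: "riemannian_manifold M" and conn: "connected (UNIV :: 'a set)"
  shows "length_dist M p q < \<infinity>"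
proof -
  have tr: "length_dist M p r < \<infinity>" if "length_dist M p q < \<infinity>" "length_dist M q r < \<infinity>" for q r
    using length_dist_triangle[OF M, of p r q] that by (auto simp: le_less_trans)
  define R where "R = {q. length_dist M p q < \<infinity>}"
  have "open R"
  proof (subst open_subopen, intro ballI)
    fix q assume q: "q \<in> R"
    obtain V where "open V" "q \<in> V" "\<And>q r. q \<in> V \<Longrightarrow> r \<in> V \<Longrightarrow> length_dist M q r < \<infinity>"
      using length_dist_locally_finite[OF M] by metis
    then show "\<exists>T. open T \<and> q \<in> T \<and> T \<subseteq> R"
      using q tr by (intro exI[of _ V]) (auto simp: R_def)
  qed
  moreover have "open (- R)"
  proof (subst open_subopen, intro ballI)
    fix q assume q: "q \<in> - R"
    obtain V where "open V" "q \<in> V" "\<And>q r. q \<in> V \<Longrightarrow> r \<in> V \<Longrightarrow> length_dist M q r < \<infinity>"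
      using length_dist_locally_finite[OF M] by metis
    \<comment> \<open>A point of \<open>V\<close> at finite distance from \<open>p\<close> would put
      \<open>q\<close> at finite distance too. Distances within \<open>V\<close> are finite in
      either order, so symmetry is not invoked.\<close>
    then show "\<exists>T. open T \<and> q \<in> T \<and> T \<subseteq> - R"
      using q tr by (intro exI[of _ V]) (auto simp: R_def)
  qed
  moreover have "p \<in> R"
    by (simp add: R_def length_dist_refl[OF M])
  ultimately have "R = UNIV"
    using connectedD[OF conn, of R "- R"] by auto
  then show ?thesis by (auto simp: R_def)
qed

lemma riem_dist_refl: "riemannian_manifold M \<Longrightarrow> riem_dist M p p = 0"
  by (simp add: riem_dist_def length_dist_refl flip: length_dist_def)

text \<open>Finiteness of all distances is what lets \<open>enn2real\<close> respect the inequality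
  and the sum; connectedness enters here.\<close>

lemma riem_dist_triangle:
  fixes M :: "'a::topological_space riemannian"
  assumes M: "riemannian_manifold M" and conn: "connected (UNIV :: 'a set)"
  shows "riem_dist M p r \<le> riem_dist M p q + riem_dist M q r"
proof -
  have "enn2real (length_dist M p r) \<le> enn2real (length_dist M p q + length_dist M q r)"
    using length_dist_triangle[OF M] length_dist_finite[OF M conn]
    by (intro enn2real_mono) auto
  also have "\<dots> = enn2real (length_dist M p q) + enn2real (length_dist M q r)"
    using length_dist_finite[OF M conn] by (intro enn2real_plus) auto
  finally show ?thesis
    by (simp add: riem_dist_def flip: length_dist_def)
qed

section \<open>Bounded displacement and controlled sets\<close>

lemma lipschitz_homotopy_bounded:
  assumes M: "riemannian_manifold M" and H: "lipschitz_homotopy M N F F' H"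
  obtains C where "\<And>x. riem_dist N (F x) (F' x) \<le> C" and "\<And>x. riem_dist N (F' x) (F x) \<le> C"
proof -
  obtain C where C: "\<And>y z. y \<in> UNIV \<times> {0..1} \<Longrightarrow> z \<in> UNIV \<times> {0..1} \<Longrightarrow>
      riem_dist N (H y) (H z) \<le> C * cylinder_dist M y z"
    using H unfolding lipschitz_homotopy_def lipschitz_wrt_def by blast
  show thesis
  proof
    \<comment> \<open>The two ends of the segment over \<open>x\<close> have cylinder distance
      \<open>sqrt (0 + 1) = 1\<close>, so the Lipschitz constant itself is the bound.\<close>
    show "riem_dist N (F x) (F' x) \<le> C" for x
      using C[of "(x, 0)" "(x, 1)"] H
      by (simp add: cylinder_dist_def riem_dist_refl[OF M] lipschitz_homotopy_def dist_real_def)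
    show "riem_dist N (F' x) (F x) \<le> C" for x
      using C[of "(x, 1)" "(x, 0)"] H
      by (simp add: cylinder_dist_def riem_dist_refl[OF M] lipschitz_homotopy_def dist_real_def)
  qed
qed

text \<open>The image of a pair under \<open>f'\<close> is compared with its image under
  \<open>f\<close> at both ends, by two triangle inequalities in \<open>N\<close>. Bounds in both
  orders replace an appeal to symmetry of the distance.\<close>

lemma controlled_set_bounded_distance:
  fixes N :: "'b::topological_space riemannian"
  assumes N: "riemannian_manifold N" "connected (UNIV :: 'b set)"
    and C: "\<And>x. riem_dist N (f x) (f' x) \<le> C" "\<And>x. riem_dist N (f' x) (f x) \<le> C"
    and E: "controlled_set N f E"
  shows "controlled_set N f' E"
proof -
  from E obtain B where B: "\<And>s t. (s, t) \<in> E \<Longrightarrow>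
      riem_dist N (case_sum f id s) (case_sum f id t) \<le> B"
    unfolding controlled_set_def close_maps_def by force
  \<comment> \<open>On the summand \<open>N\<close> both maps are the identity and the distance is
    \<open>0\<close>; \<open>max C 0\<close> covers both summands.\<close>
  have C': "riem_dist N (case_sum f id s) (case_sum f' id s) \<le> max C 0"
    "riem_dist N (case_sum f' id s) (case_sum f id s) \<le> max C 0" for s
    using C by (cases s; auto simp: riem_dist_refl[OF N(1)] le_max_iff_disj)+
  have "riem_dist N (case_sum f' id s) (case_sum f' id t) \<le> max C 0 + B + max C 0"
    if "(s, t) \<in> E" for s t
    using riem_dist_triangle[OF N, of "case_sum f' id s" "case_sum f' id t" "case_sum f id s"]
      riem_dist_triangle[OF N, of "case_sum f id s" "case_sum f' id t" "case_sum f id t"]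
      C'(2)[of s] C'(1)[of t] B[OF that] by linarith
  then show ?thesis
    unfolding controlled_set_def close_maps_def by (intro exI ballI) auto
qed

theorem corollary2p4p2:
  fixes M :: "'a::{t2_space, second_countable_topology} riemannian"
    and N :: "'b::{t2_space, second_countable_topology} riemannian"
    and G :: "('g, 'k) monoid_scheme"
    and \<rho> :: "'g \<Rightarrow> 'a \<Rightarrow> 'a"
    and \<sigma> :: "'g \<Rightarrow> 'b \<Rightarrow> 'b"
    and f f' :: "'a \<Rightarrow> 'b"
  assumes "riemannian_manifold M" and "connected (UNIV :: 'a set)"
    and "riemannian_manifold N" and "connected (UNIV :: 'b set)"
    and "acts_by_isometries G M \<rho>" and "acts_by_isometries G N \<sigma>"
    and "lipschitz_homotopy_equivalence M N f" and "lipschitz_homotopy_equivalence M N f'"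
    and "equivariantly_lipschitz_homotopic G M \<rho> N \<sigma> f f'"
  shows "C_star G M \<rho> N \<sigma> f = C_star G M \<rho> N \<sigma> f' \<and> D_star G M \<rho> N \<sigma> f = D_star G M \<rho> N \<sigma> f'"
proof -
  obtain H where "lipschitz_homotopy M N f f' H"
    using assms(9) by (auto simp: equivariantly_lipschitz_homotopic_def)
  then obtain C where "\<And>x. riem_dist N (f x) (f' x) \<le> C" "\<And>x. riem_dist N (f' x) (f x) \<le> C"
    using lipschitz_homotopy_bounded[OF assms(1)] by metis
  \<comment> \<open>The two bounds are exchanged when \<open>f\<close> and \<open>f'\<close> are, so
    the lemma gives both implications.\<close>
  then have "controlled_set N f = controlled_set N f'"
    using controlled_set_bounded_distance[OF assms(3,4)] by (intro ext iffI) blast+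
  then have "controlled_op M N f = controlled_op M N f'"
    by (intro ext) (simp add: controlled_op_def)
  then show ?thesis by (simp add: C_star_def D_star_def)
qed

end
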